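(* Let $L'$ and $R'$ denote the sets of left, respectively right, endpoints of the connected components of the open set $(1,\infty)\setminus\overline{\mathcal U}$. Then $$L'=\mathbb N\cup(\overline{\mathcal U}\setminus\mathcal U)\quad\text{and}\quad R'\subsetneq\mathcal U\setminus\mathbb N.$$
   Context: $\mathbb N=\{1,2,\dots\}$. For a real $q>1$, an expansion of a real number $x$ in base $q$ is a sequence $(c_i)_{i\ge1}$ of integers with $0\le c_i<q$ for all $i\ge1$ and $x=\sum_{i\ge1}c_iq^{-i}$. $\mathcal U$ is the set of real numbers $q>1$ for which $1$ has exactly one expansion in base $q$ (in particular $\mathcal U$ contains the integers $2,3,\dots$), and $\overline{\mathcal U}$ is its topological closure. *)

theory Defs
  imports "HOL-Analysis.Analysis"
begin

text \<open>Digit sequences are indexed from 0: the entry \<open>c i\<close> is the digit of weight \<open>q\<close> to the power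
  \<open>-(i + 1)\<close>, i.e. \<open>c 0, c 1, ...\<close> are the digits written \<open>c_1, c_2, ...\<close> on paper.\<close>

definition is_expansion :: "real \<Rightarrow> (nat \<Rightarrow> int) \<Rightarrow> real \<Rightarrow> bool" where
  "is_expansion q c x \<longleftrightarrow>
     (\<forall>i. 0 \<le> c i \<and> real_of_int (c i) < q) \<and>
     (\<lambda>i. real_of_int (c i) / q ^ Suc i) sums x"

definition univoque_bases :: "real set" where
  "univoque_bases = {q. q > 1 \<and> (\<exists>!c. is_expansion q c 1)}"

text \<open>Components of an open subset of the line are open intervals; the endpoints of such an interval
  are its infimum and supremum. The boundedness conditions exclude infinite endpoints, for which
  \<open>Inf\<close> and \<open>Sup\<close> on the reals carry no information.\<close>

definition left_endpoints :: "real set \<Rightarrow> real set" where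
  "left_endpoints S = {Inf C | C. C \<in> components S \<and> bdd_below C}"

definition right_endpoints :: "real set \<Rightarrow> real set" where
  "right_endpoints S = {Sup C | C. C \<in> components S \<and> bdd_above C}"

definition pos_naturals :: "real set" where
  "pos_naturals = {real n | n. n \<ge> 1}"

end

theory Submission
  imports Defs
begin

text \<open>Write \<open>U\<close> for the set of univoque bases. An endpoint of a component of an open set is a
  point outside the set next to which a one-sided interval lies inside it
  (\<open>mem_left_endpoints_iff\<close>, \<open>right_endpointsD\<close>). The theorem thus reduces to four statements on
  how \<open>U\<close> accumulates at a point \<open>q\<close>.

  \<^enum> If \<open>q > 1\<close> is not in \<open>U\<close>, or if \<open>q\<close> is a positive integer, then \<open>U\<close> misses an interval to the
    right of \<open>q\<close> (\<open>gap_right_of_non_univoque\<close>, \<open>gap_right_of_integer\<close>).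
  \<^enum> Every integer \<open>n \<ge> 2\<close> is a limit from the left of elements of \<open>U\<close> (\<open>integer_left_limit\<close>).
  \<^enum> Every non-integer element of \<open>U\<close> is a limit from the right of elements of \<open>U\<close>
    (\<open>univoque_right_limit\<close>).
  \<^enum> Some non-integer element of \<open>U\<close> is a limit from the left of elements of \<open>U\<close>
    (\<open>exists_univoque_left_limit\<close>).

  By 1, a point of the closure outside \<open>U\<close> can only be reached by \<open>U\<close> from the left. So 1 to 3
  describe the left endpoints; 1 and 2 exclude all points outside \<open>U\<close> and all integers as right
  endpoints; and 4 makes the second inclusion proper.

  For 1, the prefixes of expansions of 1 are the words whose remainder lies between 0 and
  \<open>M / (q - 1)\<close>, where \<open>M\<close> is the largest digit. If 1 has two expansions in a non-integer base \<open>q\<close>,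
  there are two distinct prefixes of the same length with remainder strictly below the upper
  bound: this is clear unless one of the expansions is \<open>a_1 ... a_k\<close> followed by \<open>M\<close> forever, and
  then prefixes can be built from \<open>a_1 ... a_k\<close> and its digitwise mirror image
  (\<open>non_univoque_prefixes\<close>). The remainders are continuous in the base, and they remain nonnegative
  when the base grows, so both words are still prefixes in slightly larger bases.

  For 2 to 4, \<open>q\<close> is in \<open>U\<close> as soon as its expansion \<open>c\<close> satisfies the lexicographic conditions
  \<open>admissible\<close>, and conversely (\<open>admissible_imp_univoque\<close>, \<open>univoque_imp_admissible\<close>). It therefore
  suffices to exhibit admissible sequences that share long prefixes with a given one, and to find
  their bases with the intermediate value theorem (\<open>exists_base\<close>). For 3, the sequence \<open>c\<close> is
  replaced by \<open>c_1 ... c_(k-1) (c_k + 1)\<close> followed by the mirror image of \<open>c\<close>, for a suitable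
  position \<open>k\<close> (\<open>admissible_raise_at\<close>).\<close>

section \<open>Digit sequences and their values\<close>

text \<open>Sequences over the alphabet \<open>0, ..., M\<close>. The digits allowed in base \<open>q\<close> are those with \<open>M\<close>
  the integer such that \<open>M < q \<le> M + 1\<close>; this integer is carried along as a parameter.\<close>

definition digits :: "int \<Rightarrow> (nat \<Rightarrow> int) \<Rightarrow> bool" where
  "digits M c \<longleftrightarrow> (\<forall>i. 0 \<le> c i \<and> c i \<le> M)"

text \<open>The value in base \<open>q\<close>, with the first digit having weight \<open>1 / q\<close>.\<close>

definition dval :: "real \<Rightarrow> (nat \<Rightarrow> int) \<Rightarrow> real" where
  "dval q c = (\<Sum>i. real_of_int (c i) / q ^ Suc i)"

text \<open>The sequence without its first \<open>n\<close> digits.\<close>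

definition shift :: "nat \<Rightarrow> (nat \<Rightarrow> int) \<Rightarrow> nat \<Rightarrow> int" where
  "shift n c i = c (n + i)"

text \<open>The digitwise reflection; it turns upper bounds on digits into lower bounds and exchanges the
  greedy and the lazy conditions.\<close>

definition mirror :: "int \<Rightarrow> (nat \<Rightarrow> int) \<Rightarrow> nat \<Rightarrow> int" where
  "mirror M c i = M - c i"

lemma digitsD: "digits M c \<Longrightarrow> 0 \<le> c i" "digits M c \<Longrightarrow> c i \<le> M"
  by (auto simp: digits_def)

lemma digits_shift: "digits M c \<Longrightarrow> digits M (shift n c)"
  by (simp add: digits_def shift_def)

lemma digits_mirror: "digits M c \<Longrightarrow> digits M (mirror M c)"
  by (simp add: digits_def mirror_def)

lemma digits_upd: "digits M c \<Longrightarrow> 0 \<le> y \<Longrightarrow> y \<le> M \<Longrightarrow> digits M (c(i := y))"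
  by (simp add: digits_def)

lemma digits_const: "0 \<le> M \<Longrightarrow> digits M (\<lambda>_. M)"
  by (simp add: digits_def)

lemma dval_const_sums:
  assumes "1 < q"
  shows "(\<lambda>i. real_of_int M / q ^ Suc i) sums (real_of_int M / (q - 1))"
proof -
  have "(\<lambda>i. (1 / q) ^ i) sums (1 / (1 - 1 / q))"
    using assms by (intro geometric_sums) simp
  then have "(\<lambda>i. (real_of_int M / q) * (1 / q) ^ i) sums ((real_of_int M / q) * (1 / (1 - 1 / q)))"
    by (rule sums_mult)
  moreover have "(real_of_int M / q) * (1 / (1 - 1 / q)) = real_of_int M / (q - 1)"
    using assms by (simp add: field_simps)
  moreover have "(\<lambda>i. (real_of_int M / q) * (1 / q) ^ i) = (\<lambda>i. real_of_int M / q ^ Suc i)"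
    by (simp add: power_divide)
  ultimately show ?thesis by metis
qed

lemma dval_const: "1 < q \<Longrightarrow> dval q (\<lambda>_. M) = real_of_int M / (q - 1)"
  unfolding dval_def using dval_const_sums[THEN sums_unique] by metis

lemma dval_summable:
  assumes "1 < q" "digits M c"
  shows "summable (\<lambda>i. real_of_int (c i) / q ^ Suc i)"
proof (rule summable_comparison_test')
  show "summable (\<lambda>i. real_of_int M / q ^ Suc i)"
    using dval_const_sums[OF assms(1)] by (rule sums_summable)
  show "norm (real_of_int (c n) / q ^ Suc n) \<le> real_of_int M / q ^ Suc n" for n
    using assms digitsD[OF assms(2), of n] by (auto intro!: divide_right_mono)
qed

lemma dval_sums:
  assumes "1 < q" "digits M c"
  shows "(\<lambda>i. real_of_int (c i) / q ^ Suc i) sums dval q c"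
  unfolding dval_def using dval_summable[OF assms] by (rule summable_sums)

lemma dval_nonneg:
  assumes "1 < q" "digits M c"
  shows "0 \<le> dval q c"
  unfolding dval_def using assms digitsD[OF assms(2)]
  by (intro suminf_nonneg dval_summable[OF assms]) auto

lemma dval_pos:
  assumes "1 < q" "digits M c" "0 < c i"
  shows "0 < dval q c"
  unfolding dval_def using assms digitsD[OF assms(2)]
  by (intro suminf_pos2[where i = i] dval_summable[OF assms(1,2)]) auto

lemma dval_mirror:
  assumes "1 < q" "digits M c"
  shows "dval q (mirror M c) = real_of_int M / (q - 1) - dval q c"
proof -
  have "(\<lambda>i. real_of_int M / q ^ Suc i - real_of_int (c i) / q ^ Suc i)
          sums (real_of_int M / (q - 1) - dval q c)"
    by (intro sums_diff dval_const_sums dval_sums[OF assms] assms)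
  then have "(\<lambda>i. real_of_int (mirror M c i) / q ^ Suc i) sums (real_of_int M / (q - 1) - dval q c)"
    by (simp add: mirror_def diff_divide_distrib)
  then show ?thesis unfolding dval_def by (rule sums_unique[symmetric])
qed

lemma dval_le:
  assumes "1 < q" "digits M c"
  shows "dval q c \<le> real_of_int M / (q - 1)"
  using dval_nonneg[OF assms(1) digits_mirror[OF assms(2)]] dval_mirror[OF assms] by simp

lemma dval_split:
  assumes "1 < q" "digits M c"
  shows "dval q c = (\<Sum>i<n. real_of_int (c i) / q ^ Suc i) + dval q (shift n c) / q ^ n"
proof -
  have "dval q c = (\<Sum>i. real_of_int (c (i + n)) / q ^ Suc (i + n))
                    + (\<Sum>i<n. real_of_int (c i) / q ^ Suc i)"
    unfolding dval_def by (rule suminf_split_initial_segment[OF dval_summable[OF assms]])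
  also have "(\<Sum>i. real_of_int (c (i + n)) / q ^ Suc (i + n))
               = (\<Sum>i. (real_of_int (shift n c i) / q ^ Suc i) / q ^ n)"
    by (simp add: shift_def power_add add.commute mult.assoc)
  also have "\<dots> = dval q (shift n c) / q ^ n"
    unfolding dval_def
    by (rule suminf_divide[OF dval_summable[OF assms(1) digits_shift[OF assms(2)]]])
  finally show ?thesis by simp
qed

lemma dval_antimono_strict:
  assumes "1 < x" "x < y" "digits M c" "0 < c i"
  shows "dval y c < dval x c"
proof -
  have s: "(\<lambda>i. real_of_int (c i) / x ^ Suc i - real_of_int (c i) / y ^ Suc i) sums (dval x c - dval y c)"
    using assms by (intro sums_diff dval_sums) auto
  have pw: "1 / y ^ Suc n < 1 / x ^ Suc n" for n
    using assms by (intro divide_strict_left_mono power_strict_mono) auto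
  have "0 \<le> real_of_int (c n) / x ^ Suc n - real_of_int (c n) / y ^ Suc n" for n
    using mult_left_mono[OF less_imp_le[OF pw[of n]], of "real_of_int (c n)"] digitsD[OF assms(3), of n]
    by simp
  moreover have "0 < real_of_int (c i) / x ^ Suc i - real_of_int (c i) / y ^ Suc i"
    using mult_strict_left_mono[OF pw[of i], of "real_of_int (c i)"] assms(4) by simp
  ultimately have "0 < (\<Sum>i. real_of_int (c i) / x ^ Suc i - real_of_int (c i) / y ^ Suc i)"
    by (intro suminf_pos2[OF sums_summable[OF s], of i]) auto
  then show ?thesis using sums_unique[OF s] by simp
qed

text \<open>In a fixed base, sequences with a long common prefix have nearly equal values, uniformly in the
  sequences.\<close>

lemma dval_close:
  assumes "1 < x" "0 \<le> M" "0 < e"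
  shows "\<exists>K. \<forall>c c'. digits M c \<longrightarrow> digits M c' \<longrightarrow> (\<forall>i<K. c' i = c i) \<longrightarrow> \<bar>dval x c' - dval x c\<bar> < e"
proof -
  define B where "B = real_of_int M / (x - 1)"
  have B: "0 \<le> B" using assms by (simp add: B_def)
  obtain K where K: "B / e < x ^ K" using assms(1) real_arch_pow by blast
  then have K': "B / x ^ K < e" using assms by (simp add: field_simps)
  have "\<bar>dval x c' - dval x c\<bar> < e"
    if d: "digits M c" "digits M c'" and eq: "\<forall>i<K. c' i = c i" for c c'
  proof -
    have "dval x c' - dval x c = (dval x (shift K c') - dval x (shift K c)) / x ^ K"
      using eq by (simp add: dval_split[OF assms(1) d(1), of K] dval_split[OF assms(1) d(2), of K]
          diff_divide_distrib)
    moreover have "\<bar>dval x (shift K c') - dval x (shift K c)\<bar> \<le> B"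
      using dval_nonneg[OF assms(1) digits_shift[OF d(1)], of K] dval_le[OF assms(1) digits_shift[OF d(1)], of K]
        dval_nonneg[OF assms(1) digits_shift[OF d(2)], of K] dval_le[OF assms(1) digits_shift[OF d(2)], of K]
      unfolding B_def by linarith
    ultimately have "\<bar>dval x c' - dval x c\<bar> \<le> B / x ^ K"
      using assms(1) by (simp add: abs_divide divide_right_mono)
    then show ?thesis using K' by simp
  qed
  then show ?thesis by blast
qed

lemma dval_isCont:
  assumes "1 < x" "digits M c"
  shows "isCont (\<lambda>y. dval y c) x"
proof -
  define P where "P z = (\<Sum>i. real_of_int (c i) * z ^ i)" for z :: real
  obtain K where K: "1 / x < K" "K < 1" using dense[of "1 / x" 1] assms(1) by auto
  have "0 < 1 / x" using assms(1) by simp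
  then have "0 < K" using K by linarith
  have "summable (\<lambda>i. real_of_int (c i) / (1 / K) ^ Suc i)"
    using K \<open>0 < K\<close> by (intro dval_summable[OF _ assms(2)]) auto
  then have "summable (\<lambda>i. K * (real_of_int (c i) * K ^ i))"
    using \<open>0 < K\<close> by (simp add: power_divide algebra_simps)
  then have "summable (\<lambda>i. real_of_int (c i) * K ^ i)"
    using \<open>0 < K\<close> by (simp add: summable_cmult_iff)
  then have P: "isCont P (1 / x)"
    unfolding P_def by (rule isCont_powser) (use K \<open>0 < 1 / x\<close> in auto)
  have "isCont (\<lambda>y. P (1 / y) / y) x"
    using assms(1) by (intro continuous_intros isCont_o2[where f = "\<lambda>y. 1 / y" and g = P, OF _ P]) auto
  moreover have "\<forall>\<^sub>F y in nhds x. P (1 / y) / y = dval y c"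
  proof -
    have "\<forall>\<^sub>F y in nhds x. 1 < y" using assms(1) eventually_nhds_in_open[of "{1<..}" x] by auto
    then show ?thesis
    proof eventually_elim
      case (elim y)
      have "dval y c = (\<Sum>i. (1 / y) * (real_of_int (c i) * (1 / y) ^ i))"
        unfolding dval_def by (simp add: power_divide)
      also have "\<dots> = (1 / y) * P (1 / y)"
        unfolding P_def
      proof (rule suminf_mult)
        have "summable (\<lambda>i. y * (real_of_int (c i) / y ^ Suc i))"
          by (intro summable_mult dval_summable[OF elim assms(2)])
        then show "summable (\<lambda>i. real_of_int (c i) * (1 / y) ^ i)"
          using elim by (simp add: power_divide)
      qed
      finally show ?case by simp
    qed
  qed
  ultimately show ?thesis by (subst isCont_cong[symmetric])
qed

lemma exists_base:
  assumes "1 < a" "a < b" "digits M c" "1 < dval a c" "dval b c < 1"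
  shows "\<exists>q. a < q \<and> q < b \<and> dval q c = 1"
proof -
  have "\<exists>q\<ge>a. q \<le> b \<and> dval q c = 1"
    using assms by (intro IVT2) (auto intro!: dval_isCont)
  then show ?thesis using assms by (metis less_eq_real_def less_irrefl)
qed

section \<open>Expansions with a prescribed beginning\<close>

lemma is_expansion_iff:
  assumes "1 < q" "real_of_int M < q" "q \<le> real_of_int M + 1"
  shows "is_expansion q c x \<longleftrightarrow> digits M c \<and> dval q c = x"
proof -
  have "real_of_int (c i) < q \<longleftrightarrow> c i \<le> M" for i
    using assms by linarith
  then have d: "(\<forall>i. 0 \<le> c i \<and> real_of_int (c i) < q) \<longleftrightarrow> digits M c"
    by (simp add: digits_def)
  show ?thesis
    unfolding is_expansion_def d using dval_sums[OF assms(1)] sums_unique2 by blast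
qed

lemma univoque_iff:
  assumes "1 < q" "real_of_int M < q" "q \<le> real_of_int M + 1"
  shows "q \<in> univoque_bases \<longleftrightarrow> (\<exists>!c. digits M c \<and> dval q c = 1)"
  using is_expansion_iff[OF assms] assms(1) by (simp add: univoque_bases_def)

text \<open>The greedy algorithm: since \<open>M \<ge> q - 1\<close>, the numbers with an expansion fill the whole interval
  from 0 to \<open>M / (q - 1)\<close>.\<close>

lemma expansion_exists:
  assumes q: "1 < q" "q \<le> real_of_int M + 1" and x: "0 \<le> x" "x \<le> real_of_int M / (q - 1)"
  shows "\<exists>c. digits M c \<and> dval q c = x"
proof -
  define r where "r = rec_nat x (\<lambda>_ y. q * y - real_of_int (min M \<lfloor>q * y\<rfloor>))"
  define c where "c n = min M \<lfloor>q * r n\<rfloor>" for n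
  have r0: "r 0 = x" and rS: "r (Suc n) = q * r n - real_of_int (c n)" for n
    by (simp_all add: r_def c_def)
  have M: "0 \<le> M" using q by linarith
  define B where "B = real_of_int M / (q - 1)"
  have B1: "1 \<le> B" using q by (simp add: B_def)
  have BM: "q * B - real_of_int M = B" using q by (simp add: B_def field_simps)
  have r: "0 \<le> r n \<and> r n \<le> B" for n
  proof (induction n)
    case 0
    then show ?case using x r0 by (simp add: B_def)
  next
    case (Suc n)
    have nn: "real_of_int (c n) \<le> q * r n" unfolding c_def by linarith
    have "r (Suc n) \<le> B"
    proof (cases "M \<le> \<lfloor>q * r n\<rfloor>")
      case True
      then have "r (Suc n) = q * r n - real_of_int M" by (simp add: rS c_def)
      also have "\<dots> \<le> q * B - real_of_int M" using Suc q by simp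
      finally show ?thesis using BM by simp
    next
      case False
      then have "c n = \<lfloor>q * r n\<rfloor>" by (simp add: c_def)
      then show ?thesis using rS[of n] B1 by linarith
    qed
    then show ?case using nn rS[of n] by simp
  qed
  have d: "digits M c"
    using M r q by (auto simp: digits_def c_def)
  have part: "(\<Sum>i<n. real_of_int (c i) / q ^ Suc i) = x - r n / q ^ n" for n
  proof (induction n)
    case 0
    then show ?case by (simp add: r0)
  next
    case (Suc n)
    have "r (Suc n) / q ^ Suc n = r n / q ^ n - real_of_int (c n) / q ^ Suc n"
      using q by (simp add: rS diff_divide_distrib)
    then show ?case using Suc by simp
  qed
  have "(\<lambda>n. r n / q ^ n) \<longlonglongrightarrow> 0"
  proof (rule Lim_null_comparison)
    show "\<forall>\<^sub>F n in sequentially. norm (r n / q ^ n) \<le> B * (1 / q) ^ n"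
      using r q by (auto simp: power_divide intro!: divide_right_mono always_eventually)
    show "(\<lambda>n. B * (1 / q) ^ n) \<longlonglongrightarrow> 0"
      using q by (intro tendsto_mult_right_zero LIMSEQ_power_zero) auto
  qed
  then have "(\<lambda>n. x - r n / q ^ n) \<longlonglongrightarrow> x - 0" by (intro tendsto_intros)
  then have "(\<lambda>i. real_of_int (c i) / q ^ Suc i) sums x"
    unfolding sums_def part by simp
  then show ?thesis using d dval_sums[OF q(1) d] sums_unique2 by blast
qed

text \<open>What is left of 1 after subtracting its first \<open>n\<close> digits, rescaled so that the remaining digits
  have to represent exactly this number. The sequence \<open>c\<close> need not be an expansion of 1; only its
  first \<open>n\<close> digits matter.\<close>

definition remainder :: "real \<Rightarrow> (nat \<Rightarrow> int) \<Rightarrow> nat \<Rightarrow> real" where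
  "remainder q c n = q ^ n * (1 - (\<Sum>i<n. real_of_int (c i) / q ^ Suc i))"

lemma remainder_0 [simp]: "remainder q c 0 = 1"
  by (simp add: remainder_def)

lemma remainder_Suc:
  "q \<noteq> 0 \<Longrightarrow> remainder q c (Suc n) = q * remainder q c n - real_of_int (c n)"
  by (simp add: remainder_def field_simps)

lemma remainder_cong: "(\<And>i. i < n \<Longrightarrow> c i = c' i) \<Longrightarrow> remainder q c n = remainder q c' n"
  by (simp add: remainder_def)

lemma remainder_expansion:
  assumes "1 < q" "digits M c" "dval q c = 1"
  shows "remainder q c n = dval q (shift n c)"
  using dval_split[OF assms(1,2), of n] assms(1,3) by (simp add: remainder_def field_simps)

lemma remainder_nonneg_mono:
  assumes "1 < q" "q \<le> q'" "\<And>i. 0 \<le> c i" "0 \<le> remainder q c n"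
  shows "0 \<le> remainder q' c n"
proof -
  have "(\<Sum>i<n. real_of_int (c i) / q' ^ Suc i) \<le> (\<Sum>i<n. real_of_int (c i) / q ^ Suc i)"
    using assms by (intro sum_mono divide_left_mono power_mono) auto
  moreover have "(\<Sum>i<n. real_of_int (c i) / q ^ Suc i) \<le> 1"
    using assms(1,4) zero_less_power[of q n] unfolding remainder_def
    by (simp only: zero_le_mult_iff) linarith
  ultimately show ?thesis using assms by (simp add: remainder_def)
qed

lemma remainder_isCont: "q \<noteq> 0 \<Longrightarrow> isCont (\<lambda>q. remainder q c n) q"
  unfolding remainder_def by (intro continuous_intros) auto

lemma prefix_extends:
  assumes q: "1 < q" "q \<le> real_of_int M + 1" and c: "digits M c"
    and r: "0 \<le> remainder q c n" "remainder q c n \<le> real_of_int M / (q - 1)"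
  shows "\<exists>d. digits M d \<and> dval q d = 1 \<and> (\<forall>i<n. d i = c i)"
proof -
  obtain e where e: "digits M e" "dval q e = remainder q c n"
    using expansion_exists[OF q r] by blast
  define d where "d i = (if i < n then c i else e (i - n))" for i
  have d: "digits M d" using c e by (simp add: digits_def d_def)
  have "shift n d = e" by (auto simp: shift_def d_def)
  then have "dval q d = (\<Sum>i<n. real_of_int (c i) / q ^ Suc i) + remainder q c n / q ^ n"
    using dval_split[OF q(1) d, of n] e by (simp add: d_def)
  also have "\<dots> = 1" using q by (simp add: remainder_def)
  finally show ?thesis using d by (auto simp: d_def)
qed

lemma not_univoque_if_two_prefixes:
  assumes q: "1 < q" "real_of_int M < q" "q \<le> real_of_int M + 1"
    and "digits M u" "0 \<le> remainder q u n" "remainder q u n \<le> real_of_int M / (q - 1)"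
    and "digits M v" "0 \<le> remainder q v n" "remainder q v n \<le> real_of_int M / (q - 1)"
    and "j < n" "u j \<noteq> v j"
  shows "q \<notin> univoque_bases"
proof -
  obtain a where a: "digits M a" "dval q a = 1" "\<forall>i<n. a i = u i"
    using prefix_extends[OF q(1,3)] assms by metis
  obtain b where b: "digits M b" "dval q b = 1" "\<forall>i<n. b i = v i"
    using prefix_extends[OF q(1,3)] assms by metis
  have "a \<noteq> b" using a b assms by metis
  then show ?thesis
    using a b unfolding univoque_iff[OF q] by blast
qed

lemma univoque_expansion:
  assumes "q \<in> univoque_bases" "real_of_int M < q" "q \<le> real_of_int M + 1"
  obtains c where "digits M c" "dval q c = 1"
proof -
  have "1 < q" using assms(1) by (simp add: univoque_bases_def)
  then show ?thesis
    using assms(1) that unfolding univoque_iff[OF \<open>1 < q\<close> assms(2,3)] by blast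
qed

lemma remainder_upd_Suc:
  assumes "q \<noteq> 0"
  shows "remainder q (c(n := y)) (Suc n) = remainder q c (Suc n) + real_of_int (c n) - real_of_int y"
proof -
  have "remainder q (c(n := y)) n = remainder q c n" by (rule remainder_cong) simp
  then show ?thesis using assms by (simp add: remainder_Suc)
qed

text \<open>If one of these bounds failed, the digit \<open>c i\<close> could be raised, respectively lowered, by one, and
  the resulting prefix would again extend to an expansion of 1.\<close>

lemma univoque_tails:
  assumes U: "q \<in> univoque_bases" and q: "real_of_int M < q" "q \<le> real_of_int M + 1"
    and c: "digits M c" "dval q c = 1"
  shows "c i < M \<Longrightarrow> dval q (shift (Suc i) c) < 1"
    and "0 < c i \<Longrightarrow> dval q (mirror M (shift (Suc i) c)) < 1"
proof -
  have q1: "1 < q" using U by (simp add: univoque_bases_def)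
  note r = remainder_expansion[OF q1 c, of "Suc i"]
  note t = dval_nonneg[OF q1 digits_shift[OF c(1)], of "Suc i"] dval_le[OF q1 digits_shift[OF c(1)], of "Suc i"]
  have False if "digits M (c(i := y))" "y \<noteq> c i" "0 \<le> remainder q (c(i := y)) (Suc i)"
      "remainder q (c(i := y)) (Suc i) \<le> real_of_int M / (q - 1)" for y
    using not_univoque_if_two_prefixes[OF q1 q c(1) _ _ that(1) that(3,4), of i] U that(2) r t by simp
  note no = this
  show "dval q (shift (Suc i) c) < 1" if "c i < M"
  proof (rule ccontr)
    assume "\<not> ?thesis"
    moreover have d: "digits M (c(i := c i + 1))"
      using that digitsD(1)[OF c(1), of i] by (intro digits_upd[OF c(1)]) auto
    ultimately show False
      using that r t q1 no[of "c i + 1"] d by (auto simp: remainder_upd_Suc)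
  qed
  show "dval q (mirror M (shift (Suc i) c)) < 1" if "0 < c i"
  proof (rule ccontr)
    assume "\<not> ?thesis"
    then have "dval q (shift (Suc i) c) + 1 \<le> real_of_int M / (q - 1)"
      using dval_mirror[OF q1 digits_shift[OF c(1)], of "Suc i"] by simp
    moreover have "digits M (c(i := c i - 1))"
      using that digitsD(2)[OF c(1), of i] by (intro digits_upd[OF c(1)]) auto
    ultimately show False
      using r t q1 no[of "c i - 1"] by (auto simp: remainder_upd_Suc)
  qed
qed

lemma first_difference:
  fixes a b :: "nat \<Rightarrow> int"
  assumes "a \<noteq> b"
  obtains k where "\<forall>i<k. a i = b i" "a k \<noteq> b k"
proof -
  have "\<exists>k. a k \<noteq> b k" using assms by auto
  then show ?thesis using that[of "LEAST k. a k \<noteq> b k"]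
    by (metis (mono_tags, lifting) LeastI not_less_Least)
qed

text \<open>Converse of \<open>univoque_tails\<close>: together they characterise univoque bases by the values of the
  tails of an expansion.\<close>

lemma univoqueI_tails:
  assumes q1: "1 < q" and q: "real_of_int M < q" "q \<le> real_of_int M + 1"
    and c: "digits M c" "dval q c = 1"
    and up: "\<And>i. c i < M \<Longrightarrow> dval q (shift (Suc i) c) < 1"
    and down: "\<And>i. 0 < c i \<Longrightarrow> dval q (mirror M (shift (Suc i) c)) < 1"
  shows "q \<in> univoque_bases"
proof -
  have "b = c" if b: "digits M b" "dval q b = 1" for b
  proof (rule ccontr)
    assume "b \<noteq> c"
    then obtain k where k: "\<forall>i<k. b i = c i" "b k \<noteq> c k" by (rule first_difference)
    have "remainder q b k = remainder q c k" using k by (intro remainder_cong) auto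
    then have *: "dval q (shift (Suc k) b) = dval q (shift (Suc k) c) + real_of_int (c k) - real_of_int (b k)"
      using remainder_expansion[OF q1 b, of "Suc k"] remainder_expansion[OF q1 c, of "Suc k"] q1
      by (simp add: remainder_Suc)
    show False
    proof (cases "c k < b k")
      case True
      then have "c k < M" using digitsD(2)[OF b(1), of k] by simp
      moreover have "real_of_int (c k) + 1 \<le> real_of_int (b k)" using True by linarith
      ultimately show False
        using up[of k] * dval_nonneg[OF q1 digits_shift[OF b(1)], of "Suc k"] by linarith
    next
      case False
      then have lt: "b k < c k" using k by simp
      then have "0 < c k" using digitsD(1)[OF b(1), of k] by simp
      moreover have "real_of_int (b k) + 1 \<le> real_of_int (c k)" using lt by linarith
      ultimately show False
        using down[of k] * dval_le[OF q1 digits_shift[OF b(1)], of "Suc k"]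
          dval_mirror[OF q1 digits_shift[OF c(1)], of "Suc k"] by linarith
    qed
  qed
  then show ?thesis
    using c q1 unfolding univoque_iff[OF q1 q] by blast
qed

section \<open>Gaps to the right of non-univoque bases and of integers\<close>

text \<open>The strict upper bounds are the point: they persist when the base changes a little, whereas a
  remainder equal to \<open>M / (q - 1)\<close> exceeds the bound as soon as the base grows.\<close>

lemma non_univoque_prefixes:
  assumes q1: "1 < q" and q: "real_of_int M < q" "q < real_of_int M + 1" and nU: "q \<notin> univoque_bases"
  obtains u v n j where
    "digits M u" "0 \<le> remainder q u n" "remainder q u n < real_of_int M / (q - 1)"
    "digits M v" "0 \<le> remainder q v n" "remainder q v n < real_of_int M / (q - 1)"
    "j < n" "u j \<noteq> v j"
proof -
  define B where "B = real_of_int M / (q - 1)"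
  have B: "1 < B" using q q1 by (simp add: B_def)
  obtain c where c: "digits M c" "dval q c = 1"
    using expansion_exists[of q M 1] q q1 B by (auto simp: B_def)
  obtain c' where c': "digits M c'" "dval q c' = 1" "c' \<noteq> c"
    using nU c q1 unfolding univoque_iff[OF q1 q(1) less_imp_le[OF q(2)]] by blast
  have "\<exists>a b k. digits M a \<and> digits M b \<and> dval q a = 1 \<and> dval q b = 1 \<and> (\<forall>i<k. a i = b i) \<and> a k < b k"
  proof -
    obtain k where k: "\<forall>i<k. c' i = c i" "c' k \<noteq> c k" using first_difference[OF c'(3)] by blast
    show ?thesis
    proof (cases "c' k < c k")
      case True
      then show ?thesis using c c' k by metis
    next
      case False
      then have "c k < c' k" using k by simp
      then show ?thesis using c c' k by metis
    qed
  qed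
  then obtain a b k where a: "digits M a" "dval q a = 1" and b: "digits M b" "dval q b = 1"
    and k: "\<forall>i<k. a i = b i" "a k < b k" by blast
  note ra = remainder_expansion[OF q1 a] and rb = remainder_expansion[OF q1 b]
  have bnd: "0 \<le> remainder q a n" "remainder q a n \<le> B" "0 \<le> remainder q b n" for n
    using dval_nonneg[OF q1 digits_shift] dval_le[OF q1 digits_shift] a b by (auto simp: ra rb B_def)
  show ?thesis
  proof (cases "remainder q a (Suc k) < B")
    case True
    have "remainder q b k = remainder q a k" using k by (intro remainder_cong) auto
    then have "remainder q b (Suc k) < remainder q a (Suc k)" using k q1 by (simp add: remainder_Suc)
    then show ?thesis using that[of a "Suc k" b k] a b k bnd True by (auto simp: B_def)
  next
    case False
    then have eq: "remainder q a (Suc k) = B" using bnd(2)[of "Suc k"] by simp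
    have aM: "a k < M" using k digitsD(2)[OF b(1), of k] by simp
    \<comment> \<open>The expansion \<open>a\<close> continues with \<open>M\<close> forever after position \<open>k\<close>. Raising its digit at \<open>k\<close>
        lowers the remainder to \<open>B - 1\<close>, which the mirror image of \<open>a\<close> represents; the mirrored
        prefix of length \<open>k + 1\<close> brings the remainder down to 0. Lowering the last digit gives a
        second prefix, with remainder 1.\<close>
    define v where "v i = (if i < k then a i else if i = k then a k + 1 else M - a (i - Suc k))" for i
    have v: "digits M v" using a aM by (auto simp: digits_def v_def)
    have "remainder q v k = remainder q a k" by (intro remainder_cong) (simp add: v_def)
    then have vk: "remainder q v (Suc k) = B - 1"
      using eq q1 by (simp add: remainder_Suc v_def)
    have BM: "q * B - real_of_int M = B" using q1 by (simp add: B_def field_simps)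
    have vj: "remainder q v (Suc k + j) = B - remainder q a j" for j
    proof (induction j)
      case 0
      then show ?case using vk by simp
    next
      case (Suc j)
      have v_j: "v (Suc k + j) = M - a j" by (simp add: v_def)
      have "remainder q v (Suc k + Suc j) = q * (B - remainder q a j) - real_of_int (M - a j)"
        using Suc q1 remainder_Suc[of q v "Suc k + j"] v_j by simp
      also have "\<dots> = B - remainder q a (Suc j)"
        using BM q1 by (simp add: remainder_Suc algebra_simps)
      finally show ?case .
    qed
    define n where "n = Suc k + k"
    have v0: "remainder q v (Suc n) = 0" using vj[of "Suc k"] eq by (simp add: n_def)
    have vn: "v n = M - a k" by (simp add: v_def n_def)
    define u where "u = v(n := v n - 1)"
    have u: "digits M u"
      using v aM digitsD(2)[OF v, of n] by (auto simp: digits_def u_def vn)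
    have "remainder q u (Suc n) = 1" using v0 q1 by (simp add: u_def remainder_upd_Suc)
    then show ?thesis
      using that[of u "Suc n" v n] u v v0 B by (auto simp: u_def B_def)
  qed
qed

lemma gap_right_of_non_univoque:
  assumes q1: "1 < q" and q: "real_of_int M < q" "q < real_of_int M + 1" and nU: "q \<notin> univoque_bases"
  shows "\<exists>e>q. {q<..<e} \<inter> univoque_bases = {}"
proof -
  obtain u v n j where
    u: "digits M u" "0 \<le> remainder q u n" "remainder q u n < real_of_int M / (q - 1)" and
    v: "digits M v" "0 \<le> remainder q v n" "remainder q v n < real_of_int M / (q - 1)" and
    j: "j < n" "u j \<noteq> v j"
    by (rule non_univoque_prefixes[OF assms])
  have ev: "\<forall>\<^sub>F x in at_right q. remainder x w n < real_of_int M / (x - 1)"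
    if "remainder q w n < real_of_int M / (q - 1)" for w
  proof -
    have "isCont (\<lambda>x. real_of_int M / (x - 1) - remainder x w n) q"
      using q1 by (intro continuous_intros remainder_isCont) auto
    then have "\<forall>\<^sub>F x in at q. 0 < real_of_int M / (x - 1) - remainder x w n"
      using that unfolding isCont_def by (intro order_tendstoD(1)) auto
    then show ?thesis by (simp add: eventually_at_split)
  qed
  have "\<forall>\<^sub>F x in at_right q. x < real_of_int M + 1"
    using q(2) eventually_at_right_field by blast
  with ev[OF u(3)] ev[OF v(3)]
  have "\<forall>\<^sub>F x in at_right q. remainder x u n < real_of_int M / (x - 1)
          \<and> remainder x v n < real_of_int M / (x - 1) \<and> x < real_of_int M + 1"
    by eventually_elim simp
  then obtain e where e: "q < e" "\<And>x. q < x \<Longrightarrow> x < e \<Longrightarrow> remainder x u n < real_of_int M / (x - 1)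
          \<and> remainder x v n < real_of_int M / (x - 1) \<and> x < real_of_int M + 1"
    unfolding eventually_at_right_field by blast
  have "x \<notin> univoque_bases" if x: "q < x" "x < e" for x
  proof (rule not_univoque_if_two_prefixes[OF _ _ _ u(1) _ _ v(1) _ _ j])
    show "0 \<le> remainder x u n" "0 \<le> remainder x v n"
      using remainder_nonneg_mono[OF q1 less_imp_le[OF x(1)]] u v digitsD by metis+
  qed (use x q1 q e(2)[OF x] in auto)
  then show ?thesis using e(1) by (intro exI[of _ e]) auto
qed

text \<open>In a base slightly above \<open>n\<close>, both \<open>n\<close> and \<open>n - 1\<close> can be the first digit of an expansion of 1.
  For \<open>n = 1\<close> this shows that univoque bases stay away from 1.\<close>

lemma gap_right_of_integer:
  fixes n :: nat
  assumes "1 \<le> n"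
  shows "\<exists>e>real n. {real n<..<e} \<inter> univoque_bases = {}"
proof -
  have one: "x \<notin> univoque_bases" if x: "real n < x" "x < real n + 1" "(x - real n) * x \<le> 1" for x
  proof (rule not_univoque_if_two_prefixes[of x "int n" "\<lambda>_. int n" "Suc 0" "\<lambda>_. int n - 1" 0])
    have *: "x - real n + 1 \<le> real n / (x - 1)" "1 < x"
    proof -
      show "1 < x" using assms x by simp
      have "(x - real n + 1) * (x - 1) \<le> real n"
      proof -
        have "(x - real n + 1) * (x - 1) = (x - real n) * x - 1 + real n"
          by (simp add: algebra_simps)
        then show ?thesis using x(3) by simp
      qed
      then show "x - real n + 1 \<le> real n / (x - 1)" using \<open>1 < x\<close> by (subst pos_le_divide_eq) auto
    qed
    show "remainder x (\<lambda>_. int n) (Suc 0) \<le> real_of_int (int n) / (x - 1)"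
      "remainder x (\<lambda>_. int n - 1) (Suc 0) \<le> real_of_int (int n) / (x - 1)"
      using * x by (simp_all add: remainder_Suc)
  qed (use assms x in \<open>auto simp: remainder_Suc digits_def\<close>)
  \<comment> \<open>With this bound, \<open>(x - n) x < (1 / (n + 1)) (n + 1) = 1\<close>.\<close>
  define e where "e = real n + 1 / (real n + 1)"
  have "(x - real n) * x \<le> 1" "x < real n + 1" if "real n < x" "x < e" for x
  proof -
    have d: "x - real n < 1 / (real n + 1)" using that by (simp add: e_def)
    also have "\<dots> \<le> 1" by simp
    finally show "x < real n + 1" by simp
    then have "(x - real n) * x \<le> (1 / (real n + 1)) * (real n + 1)"
      using d that by (intro mult_mono) auto
    then show "(x - real n) * x \<le> 1" by simp
  qed
  then show ?thesis using one by (intro exI[of _ e]) (auto simp: e_def)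
qed

section \<open>Lexicographically admissible sequences\<close>

text \<open>The strict lexicographic order on sequences.\<close>

definition lexless :: "(nat \<Rightarrow> int) \<Rightarrow> (nat \<Rightarrow> int) \<Rightarrow> bool" where
  "lexless d c \<longleftrightarrow> (\<exists>j. (\<forall>i<j. d i = c i) \<and> d j < c j)"

text \<open>The lexicographic description of unique expansions of 1: tails after a non-maximal digit, and
  mirrored tails after a nonzero digit, are smaller than the sequence itself. No base occurs here.\<close>

definition admissible :: "int \<Rightarrow> (nat \<Rightarrow> int) \<Rightarrow> bool" where
  "admissible M c \<longleftrightarrow> digits M c
     \<and> (\<forall>i. c i < M \<longrightarrow> lexless (shift (Suc i) c) c)
     \<and> (\<forall>i. 0 < c i \<longrightarrow> lexless (mirror M (shift (Suc i) c)) c)"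

lemma lexless_trans:
  assumes "lexless a b" "lexless b c"
  shows "lexless a c"
proof -
  obtain j where j: "\<forall>i<j. a i = b i" "a j < b j" using assms(1) by (auto simp: lexless_def)
  obtain k where k: "\<forall>i<k. b i = c i" "b k < c k" using assms(2) by (auto simp: lexless_def)
  have "\<forall>i<min j k. a i = c i" using j k by auto
  moreover have "a (min j k) < c (min j k)" using j k by (cases j k rule: linorder_cases) auto
  ultimately show ?thesis unfolding lexless_def by blast
qed

text \<open>From lexicographic to numerical bounds. The family \<open>D\<close> consists of sequences below \<open>c\<close> that
  re-enter \<open>D\<close> after their first difference with \<open>c\<close>. At that place at least \<open>1 / q ^ Suc j\<close> is
  lost against \<open>c\<close>, so a supremum of the values above 1 would contract towards 1, a contradiction.
  As \<open>c\<close> has no zero tail, all values are strictly below 1.\<close>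

lemma dval_less_one:
  assumes q1: "1 < q" and c: "digits M c" "dval q c = 1"
    and tail: "\<And>n. 0 < dval q (shift n c)"
    and D: "\<And>d. d \<in> D \<Longrightarrow> digits M d"
      "\<And>d. d \<in> D \<Longrightarrow> \<exists>j. (\<forall>i<j. d i = c i) \<and> d j < c j \<and> shift (Suc j) d \<in> D"
    and "d \<in> D"
  shows "dval q d < 1"
proof -
  have step: "\<exists>e\<in>D. \<exists>j. dval q d < 1 + (dval q e - 1) / q ^ Suc j" if d: "d \<in> D" for d
  proof -
    obtain j where j: "\<forall>i<j. d i = c i" "d j < c j" "shift (Suc j) d \<in> D" using D(2)[OF d] by blast
    have "real_of_int (d j) + 1 \<le> real_of_int (c j)" using j(2) by linarith
    then have le: "real_of_int (d j) / q ^ Suc j \<le> real_of_int (c j) / q ^ Suc j - 1 / q ^ Suc j"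
      using q1 by (simp add: diff_divide_distrib[symmetric] divide_right_mono)
    have "0 < dval q (shift (Suc j) c) / q ^ Suc j"
      using tail[of "Suc j"] q1 by simp
    then have "(\<Sum>i<Suc j. real_of_int (c i) / q ^ Suc i) < 1"
      using dval_split[OF q1 c(1), of "Suc j"] c(2) by linarith
    moreover have "(\<Sum>i<j. real_of_int (d i) / q ^ Suc i) = (\<Sum>i<j. real_of_int (c i) / q ^ Suc i)"
      using j(1) by simp
    ultimately have "dval q d < 1 - 1 / q ^ Suc j + dval q (shift (Suc j) d) / q ^ Suc j"
      using dval_split[OF q1 D(1)[OF d], of "Suc j"] le by simp
    then show ?thesis using j(3) by (auto simp: diff_divide_distrib intro!: bexI exI[of _ j])
  qed
  define s where "s = Sup (dval q ` D)"
  have bdd: "bdd_above (dval q ` D)"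
    using dval_le[OF q1 D(1)] by (auto intro!: bdd_aboveI2)
  have upper: "dval q e \<le> s" if "e \<in> D" for e
    unfolding s_def using that bdd by (intro cSup_upper) auto
  have "s \<le> 1"
  proof (rule ccontr)
    assume "\<not> s \<le> 1"
    have "dval q e \<le> 1 + (s - 1) / q" if e: "e \<in> D" for e
    proof -
      obtain f j where f: "f \<in> D" "dval q e < 1 + (dval q f - 1) / q ^ Suc j"
        using step[OF e] by blast
      have "(dval q f - 1) / q ^ Suc j \<le> (s - 1) / q ^ Suc j"
        using upper[OF f(1)] q1 by (intro divide_right_mono) auto
      also have "\<dots> \<le> (s - 1) / q"
        using \<open>\<not> s \<le> 1\<close> q1 by (intro divide_left_mono) auto
      finally show ?thesis using f(2) by simp
    qed
    then have "s \<le> 1 + (s - 1) / q"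
      unfolding s_def using assms(7) by (intro cSup_least) auto
    moreover have "(s - 1) / q < s - 1"
      using \<open>\<not> s \<le> 1\<close> q1 by (simp add: divide_less_eq)
    ultimately show False by simp
  qed
  obtain e j where e: "e \<in> D" "dval q d < 1 + (dval q e - 1) / q ^ Suc j"
    using step[OF assms(7)] by blast
  have "(dval q e - 1) / q ^ Suc j \<le> 0"
    using upper[OF e(1)] \<open>s \<le> 1\<close> q1 by (intro divide_nonpos_pos) auto
  then show ?thesis using e(2) by simp
qed

text \<open>After the last nonzero digit the mirrored tail would be constantly \<open>M\<close>, which is not below \<open>c\<close>.\<close>

lemma admissible_tail_nonzero:
  assumes "admissible M c" "0 < c m"
  shows "\<exists>i\<ge>n. 0 < c i"
proof (rule ccontr)
  assume "\<not> ?thesis"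
  then have z: "\<forall>i\<ge>n. c i = 0"
  proof (intro allI impI)
    fix i assume "n \<le> i"
    then have "\<not> 0 < c i" using \<open>\<not> (\<exists>i\<ge>n. 0 < c i)\<close> by blast
    then show "c i = 0" using assms(1) digitsD(1)[of M c i] by (simp add: admissible_def)
  qed
  \<comment> \<open>Propagate the zero tail down to the first digit.\<close>
  have "\<forall>i\<ge>n - k. c i = 0" for k
  proof (induction k)
    case 0
    then show ?case using z by simp
  next
    case (Suc k)
    show ?case
    proof (cases "k < n")
      case True
      define l where "l = n - Suc k"
      have l: "Suc l = n - k" using True by (simp add: l_def)
      have "c l = 0"
      proof (rule ccontr)
        assume "c l \<noteq> 0"
        then have "lexless (mirror M (shift (Suc l) c)) c"
          using assms(1) by (simp add: admissible_def digits_def order.strict_iff_order)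
        then obtain j where "M - c (Suc l + j) < c j"
          by (auto simp: lexless_def mirror_def shift_def)
        moreover have "c (Suc l + j) = 0" using Suc l by simp
        ultimately show False using assms(1) digitsD(2)[of M c j] by (simp add: admissible_def)
      qed
      then show ?thesis using Suc l unfolding l_def[symmetric]
        by (metis le_antisym not_less_eq_eq)
    next
      case False
      then show ?thesis using Suc by simp
    qed
  qed
  from this[of n] assms(2) show False by simp
qed

lemma admissible_imp_univoque:
  assumes q1: "1 < q" and q: "real_of_int M < q" "q \<le> real_of_int M + 1"
    and c: "admissible M c" "dval q c = 1"
  shows "q \<in> univoque_bases"
proof -
  have d: "digits M c" using c by (simp add: admissible_def)
  have "\<exists>m. 0 < c m"
  proof (rule ccontr)
    assume "\<not> ?thesis"
    then have "c m = 0" for m using digitsD(1)[OF d, of m] by (simp add: order.order_iff_strict)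
    then show False using c(2) by (simp add: dval_def)
  qed
  then have "\<exists>i\<ge>n. 0 < c i" for n using admissible_tail_nonzero[OF c(1)] by blast
  then have tail: "0 < dval q (shift n c)" for n
    using dval_pos[OF q1 digits_shift[OF d]] by (metis le_iff_add shift_def)
  show ?thesis
  proof (rule univoqueI_tails[OF q1 q d c(2)])
    fix i assume i: "c i < M"
    show "dval q (shift (Suc i) c) < 1"
    proof (rule dval_less_one[OF q1 d c(2) tail])
      \<comment> \<open>At its first difference with \<open>c\<close>, such a tail has a digit below a digit of \<open>c\<close>, hence
          below \<open>M\<close>, so what follows is again a tail after a non-maximal digit.\<close>
      let ?D = "{shift (Suc i) c | i. c i < M}"
      show "shift (Suc i) c \<in> ?D" using i by blast
      show "digits M d'" if "d' \<in> ?D" for d' using that digits_shift[OF d] by blast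
      show "\<exists>j. (\<forall>i<j. d' i = c i) \<and> d' j < c j \<and> shift (Suc j) d' \<in> ?D" if d': "d' \<in> ?D" for d'
      proof -
        obtain l where l: "d' = shift (Suc l) c" "c l < M" using d' by blast
        then obtain j where j: "\<forall>i<j. d' i = c i" "d' j < c j"
          using c(1) by (auto simp: admissible_def lexless_def)
        have "c (Suc l + j) < M" using j(2) digitsD(2)[OF d, of j] by (simp add: l(1) shift_def)
        moreover have "shift (Suc j) d' = shift (Suc (Suc l + j)) c"
          by (auto simp: l(1) shift_def add_ac)
        ultimately show ?thesis using j by blast
      qed
    qed
  next
    fix i assume i: "0 < c i"
    show "dval q (mirror M (shift (Suc i) c)) < 1"
    proof (rule dval_less_one[OF q1 d c(2) tail])
      let ?D = "{mirror M (shift (Suc i) c) | i. 0 < c i}"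
      show "mirror M (shift (Suc i) c) \<in> ?D" using i by blast
      show "digits M d'" if "d' \<in> ?D" for d' using that digits_mirror[OF digits_shift[OF d]] by blast
      show "\<exists>j. (\<forall>i<j. d' i = c i) \<and> d' j < c j \<and> shift (Suc j) d' \<in> ?D" if d': "d' \<in> ?D" for d'
      proof -
        obtain l where l: "d' = mirror M (shift (Suc l) c)" "0 < c l" using d' by blast
        then obtain j where j: "\<forall>i<j. d' i = c i" "d' j < c j"
          using c(1) by (auto simp: admissible_def lexless_def)
        have "0 < c (Suc l + j)" using j(2) digitsD(2)[OF d, of j] by (simp add: l(1) shift_def mirror_def)
        moreover have "shift (Suc j) d' = mirror M (shift (Suc (Suc l + j)) c)"
          by (auto simp: l(1) shift_def mirror_def add_ac)
        ultimately show ?thesis using j by blast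
      qed
    qed
  qed
qed

lemma univoque_imp_admissible:
  assumes U: "q \<in> univoque_bases" and q: "real_of_int M < q" "q \<le> real_of_int M + 1"
    and c: "digits M c" "dval q c = 1"
  shows "admissible M c"
proof -
  have q1: "1 < q" using U by (simp add: univoque_bases_def)
  note tails = univoque_tails[OF U q c]
  have "lexless d c" if d: "digits M d" "dval q d < 1" for d
  proof -
    have "d \<noteq> c" using d c by auto
    then obtain j where j: "\<forall>i<j. d i = c i" "d j \<noteq> c j" by (rule first_difference)
    have "\<not> c j < d j"
    proof
      assume lt: "c j < d j"
      then have cM: "c j < M" using digitsD(2)[OF d(1), of j] by simp
      have "real_of_int (c j) + 1 \<le> real_of_int (d j)" using lt by linarith
      then have le: "real_of_int (c j) / q ^ Suc j + 1 / q ^ Suc j \<le> real_of_int (d j) / q ^ Suc j"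
        using q1 by (simp add: add_divide_distrib[symmetric] divide_right_mono)
      have "dval q (shift (Suc j) c) / q ^ Suc j < 1 / q ^ Suc j"
        using tails(1)[OF cM] q1 by (intro divide_strict_right_mono) auto
      moreover have "0 \<le> dval q (shift (Suc j) d) / q ^ Suc j"
        using dval_nonneg[OF q1 digits_shift[OF d(1)]] q1 by simp
      moreover have "(\<Sum>i<j. real_of_int (d i) / q ^ Suc i) = (\<Sum>i<j. real_of_int (c i) / q ^ Suc i)"
        using j(1) by simp
      ultimately show False
        using dval_split[OF q1 d(1), of "Suc j"] dval_split[OF q1 c(1), of "Suc j"] c(2) d(2) le by simp
    qed
    then show ?thesis using j unfolding lexless_def by (metis linorder_neqE)
  qed
  then show ?thesis
    unfolding admissible_def using c(1) tails digits_shift digits_mirror by metis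
qed

text \<open>A convenient source of admissible sequences: start with a block of \<open>m\<close> maximal digits, let no
  later digit below \<open>M\<close> be followed by \<open>m\<close> digits \<open>M\<close>, and no nonzero digit by \<open>m\<close> zeros. Then the tails in question are smaller than
  \<open>c\<close> already within the first \<open>m\<close> digits.\<close>

lemma admissible_if_no_blocks:
  assumes "digits M c" "\<forall>i<m. c i = M"
    and "\<And>i. c i < M \<Longrightarrow> \<exists>j<m. c (Suc i + j) < M"
    and "\<And>i. 0 < c i \<Longrightarrow> \<exists>j<m. 0 < c (Suc i + j)"
  shows "admissible M c"
proof -
  have *: "lexless d c" if d: "digits M d" "\<exists>j<m. d j < M" for d
  proof -
    obtain j where j: "d j < M" "j < m" using d by blast
    then obtain k where k: "d k < M" "\<forall>i<k. \<not> d i < M"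
      using exists_least_iff[of "\<lambda>k. d k < M"] by blast
    have "k \<le> j" using j(1) k(2) by (meson not_le)
    have "\<forall>i<k. d i = M" using k(2) digitsD(2)[OF d(1)] by (meson order.not_eq_order_implies_strict)
    then show ?thesis using k j \<open>k \<le> j\<close> assms(2) unfolding lexless_def by (intro exI[of _ k]) auto
  qed
  show ?thesis
    unfolding admissible_def
  proof (intro conjI allI impI)
    fix i
    show "lexless (shift (Suc i) c) c" if "c i < M"
      using assms(3)[OF that] by (intro *[OF digits_shift[OF assms(1)]]) (simp add: shift_def)
    show "lexless (mirror M (shift (Suc i) c)) c" if "0 < c i"
      using assms(4)[OF that]
      by (intro *[OF digits_mirror[OF digits_shift[OF assms(1)]]]) (simp add: shift_def mirror_def)
  qed (rule assms(1))
qed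

section \<open>Univoque bases accumulating at the integers from the left\<close>

lemma integer_left_limit:
  fixes n :: nat
  assumes "2 \<le> n" "a < real n"
  shows "\<exists>q\<in>univoque_bases. a < q \<and> q < real n"
proof -
  define M where "M = int n - 1"
  have M: "1 \<le> M" "real_of_int M = real n - 1" using assms by (auto simp: M_def)
  obtain x where x: "max a (max (real n - 1) 1) < x" "x < real n"
    using dense[of "max a (max (real n - 1) 1)" "real n"] assms by auto
  have v: "1 < dval x (\<lambda>_. M)" using x by (simp add: dval_const M)
  obtain K where K: "\<And>c'. digits M c' \<Longrightarrow> \<forall>i<K. c' i = M \<Longrightarrow>
      \<bar>dval x c' - dval x (\<lambda>_. M)\<bar> < dval x (\<lambda>_. M) - 1"
    using dval_close[of x M "dval x (\<lambda>_. M) - 1"] digits_const[of M] x M v by auto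
  \<comment> \<open>The sequence \<open>M\<close> repeated \<open>2 K + 2\<close> times, followed by the period \<open>0 M\<close>.\<close>
  define c where "c i = (if i < 2 * K + 2 \<or> odd i then M else 0)" for i :: nat
  have c: "digits M c" using M by (simp add: digits_def c_def)
  have adm: "admissible M c"
  proof (rule admissible_if_no_blocks[where m = 2, OF c])
    show "\<forall>i<2. c i = M" by (simp add: c_def)
    show "\<exists>j<2. c (Suc i + j) < M" if "c i < M" for i
      using that M by (intro exI[of _ 1]) (auto simp: c_def split: if_splits)
    show "\<exists>j<2. 0 < c (Suc i + j)" if "0 < c i" for i
      using M by (cases "odd i") (auto intro: exI[of _ 0] exI[of _ 1] simp: c_def)
  qed
  have "\<bar>dval x c - dval x (\<lambda>_. M)\<bar> < dval x (\<lambda>_. M) - 1"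
    by (intro K c) (auto simp: c_def)
  then have "1 < dval x c" by linarith
  moreover have "dval (real n) c < 1"
  proof -
    have "0 < dval (real n) (mirror M c)"
      using assms M by (intro dval_pos[where i = "2 * K + 2", OF _ digits_mirror[OF c]])
        (auto simp: mirror_def c_def)
    then show ?thesis using dval_mirror[of "real n" M c] c assms M by simp
  qed
  ultimately obtain q where q: "x < q" "q < real n" "dval q c = 1"
    using exists_base[of x "real n" M c] x c by auto
  have "q \<in> univoque_bases"
    using x q M by (intro admissible_imp_univoque[OF _ _ _ adm]) auto
  then show ?thesis using x q by (intro bexI[of _ q]) auto
qed

section \<open>Univoque bases accumulating at a non-integer univoque base from the right\<close>

text \<open>A tail constantly equal to \<open>M\<close> has value \<open>M / (q - 1) > 1\<close>, which is impossible after a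
  non-maximal digit; and \<open>c\<close> itself is not constantly \<open>M\<close>, because \<open>q\<close> is not an integer.\<close>

lemma univoque_not_eventually_max:
  assumes U: "q \<in> univoque_bases" and q: "real_of_int M < q" "q < real_of_int M + 1"
    and c: "digits M c" "dval q c = 1"
  shows "\<exists>i\<ge>n. c i < M"
proof (rule ccontr)
  assume "\<not> ?thesis"
  then have z: "\<forall>i\<ge>n. c i = M"
    using digitsD(2)[OF c(1)] by (auto simp: order.order_iff_strict)
  have q1: "1 < q" using U by (simp add: univoque_bases_def)
  have B: "1 < real_of_int M / (q - 1)" using q q1 by simp
  have "\<forall>i\<ge>n - k. c i = M" for k
  proof (induction k)
    case 0
    then show ?case using z by simp
  next
    case (Suc k)
    show ?case
    proof (cases "k < n")
      case True
      define l where "l = n - Suc k"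
      have l: "Suc l = n - k" using True by (simp add: l_def)
      have "shift (Suc l) c = (\<lambda>_. M)" using Suc l by (auto simp: shift_def)
      then have "\<not> dval q (shift (Suc l) c) < 1" using B q1 by (simp add: dval_const)
      then have "\<not> c l < M" using univoque_tails(1)[OF U q(1) less_imp_le[OF q(2)] c] by blast
      then have "c l = M" using digitsD(2)[OF c(1), of l] by simp
      then show ?thesis using Suc l unfolding l_def[symmetric]
        by (metis le_antisym not_less_eq_eq)
    next
      case False
      then show ?thesis using Suc by simp
    qed
  qed
  from this[of n] have "c = (\<lambda>_. M)" by auto
  then show False using B q1 c(2) by (simp add: dval_const)
qed

text \<open>The word formed by the digits with indices \<open>i + 1, ..., k\<close> is a prefix of \<open>c\<close>.\<close>

definition border :: "(nat \<Rightarrow> int) \<Rightarrow> nat \<Rightarrow> nat \<Rightarrow> bool" where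
  "border c i k \<longleftrightarrow> i < k \<and> (\<forall>l. Suc i + l \<le> k \<longrightarrow> c (Suc i + l) = c l)"

text \<open>Only borders preceded by a digit below \<open>M\<close> count. If \<open>K\<close> has one, take the longest and extend it to the place \<open>k\<close> where the tail first drops
  below \<open>c\<close>. A longer border at \<open>k\<close> would be one at \<open>K\<close>, and a shorter border at \<open>k\<close> would give a
  tail of \<open>c\<close> that exceeds \<open>c\<close>.\<close>

lemma exists_borderless:
  assumes c: "admissible M c" and "c K < M"
  shows "\<exists>k\<ge>K. c k < M \<and> (\<forall>i. c i < M \<longrightarrow> \<not> border c i k)"
proof (cases "\<exists>i. c i < M \<and> border c i K")
  case False
  then show ?thesis using assms(2) by auto
next
  case True
  define i where "i = (LEAST i. c i < M \<and> border c i K)"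
  have i: "c i < M" "border c i K"
    using LeastI_ex[OF True] by (simp_all add: i_def)
  have least: "i \<le> l" if "c l < M" "border c l K" for l
    using Least_le[of "\<lambda>i. c i < M \<and> border c i K" l] that by (simp add: i_def)
  have d: "digits M c" using c by (simp add: admissible_def)
  obtain j where j: "\<forall>l<j. c (Suc i + l) = c l" "c (Suc i + j) < c j"
    using c i(1) by (auto simp: admissible_def lexless_def shift_def)
  define k where "k = Suc i + j"
  have "K < k"
  proof (rule ccontr)
    assume "\<not> K < k"
    then have "c (Suc i + j) = c j" using i(2) by (simp add: border_def k_def)
    then show False using j(2) by simp
  qed
  moreover have "c k < M" using j(2) digitsD(2)[OF d, of j] by (simp add: k_def)
  moreover have "\<not> border c l k" if l: "c l < M" for l
  proof
    assume b: "border c l k"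
    consider "l < i" | "l = i" | "i < l" by linarith
    then show False
    proof cases
      case 1
      then have "border c l K" using b i(2) \<open>K < k\<close> by (auto simp: border_def)
      then show False using least[OF l] 1 by simp
    next
      case 2
      then show False using b j(2) by (simp add: border_def k_def)
    next
      case 3
      define p where "p = l - Suc i"
      have p: "l = Suc i + p" using 3 by (simp add: p_def)
      have "p < j" using b p by (simp add: border_def k_def)
      define r where "r = j - Suc p"
      have r: "j = Suc p + r" using \<open>p < j\<close> by (simp add: r_def)
      have "c p < M" using l j(1) \<open>p < j\<close> p by simp
      then obtain t where t: "\<forall>u<t. c (Suc p + u) = c u" "c (Suc p + t) < c t"
        using c by (auto simp: admissible_def lexless_def shift_def)
      have bb: "c (Suc l + u) = c u" if "u \<le> r" for u
        using b that p r by (simp add: border_def k_def)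
      have eq: "c (Suc p + u) = c u" if "u < r" for u
        using bb[of u] j(1)[rule_format, of "Suc p + u"] that p r by (simp add: add_ac)
      have "c r < c (Suc p + r)"
        using bb[of r] j(2) p r by (simp add: add_ac)
      then show False using t eq by (metis less_asym linorder_neqE_nat less_irrefl)
    qed
  qed
  ultimately show ?thesis by (intro exI[of _ k]) auto
qed

text \<open>Raise the digit at position \<open>k\<close> by one and continue with the mirror image of \<open>c\<close>.\<close>

definition raise_at :: "int \<Rightarrow> nat \<Rightarrow> (nat \<Rightarrow> int) \<Rightarrow> nat \<Rightarrow> int" where
  "raise_at M k c i = (if i < k then c i else if i = k then c k + 1 else M - c (i - Suc k))"

lemma raise_at_simps:
  "i < k \<Longrightarrow> raise_at M k c i = c i"
  "raise_at M k c k = c k + 1"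
  "raise_at M k c (Suc k + j) = M - c j"
  by (simp_all add: raise_at_def)

lemma digits_raise_at: "digits M c \<Longrightarrow> c k < M \<Longrightarrow> digits M (raise_at M k c)"
  by (auto simp: digits_def raise_at_def)

text \<open>The new sequence \<open>c'\<close> is larger than \<open>c\<close>, and its tails beyond position \<open>k\<close> are tails or mirrored tails
  of \<open>c\<close>, so the conditions there are inherited from \<open>c\<close>. For the tails starting before position
  \<open>k\<close>, raising the digit at \<open>k\<close> only helps the mirrored condition. It could violate the other
  one: as \<open>k\<close> has no border, the raised digit at worst equals the digit of \<open>c\<close> it is compared with,
  and then the mirror image that follows decides.\<close>

lemma admissible_raise_at:
  assumes c: "admissible M c" "c 0 = M" "0 < M"
    and k: "0 < k" "c k < M" "\<And>i. c i < M \<Longrightarrow> \<not> border c i k"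
  shows "admissible M (raise_at M k c)"
proof -
  define c' where "c' = raise_at M k c"
  note s = raise_at_simps[where k = k and M = M and c = c, folded c'_def]
  have d: "digits M c" using c by (simp add: admissible_def)
  have up: "lexless (shift (Suc i) c) c" if "c i < M" for i
    using c(1) that by (simp add: admissible_def)
  have down: "lexless (mirror M (shift (Suc i) c)) c" if "0 < c i" for i
    using c(1) that by (simp add: admissible_def)
  have cc': "lexless c c'" unfolding lexless_def using s by (intro exI[of _ k]) auto
  \<comment> \<open>The mirrored condition before \<open>k\<close>, decided at a position up to \<open>k\<close>; the raised digit makes
      the inequality at \<open>k\<close> strict.\<close>
  have mirr: "\<exists>p. Suc i + p \<le> k \<and> (\<forall>l<p. M - c' (Suc i + l) = c l) \<and> M - c' (Suc i + p) < c p"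
    if i: "i < k" "0 < c i" for i
  proof -
    obtain j where j: "\<forall>l<j. M - c (Suc i + l) = c l" "M - c (Suc i + j) < c j"
      using down[OF i(2)] by (auto simp: lexless_def mirror_def shift_def)
    show ?thesis
    proof (cases "Suc i + j < k")
      case True
      then show ?thesis using j s(1) by (intro exI[of _ j]) auto
    next
      case False
      define p where "p = k - Suc i"
      have p: "k = Suc i + p" using i by (simp add: p_def)
      have "p \<le> j" using False p by simp
      then have "M - c k \<le> c p" using j p by (cases "p = j") auto
      then have "M - c' (Suc i + p) < c p" using s(2) p by simp
      moreover have "\<forall>l<p. M - c' (Suc i + l) = c l" using j(1) \<open>p \<le> j\<close> s(1) p by simp
      ultimately show ?thesis using p by (intro exI[of _ p]) simp
    qed
  qed
  have "lexless (shift (Suc i) c') c'" if i: "c' i < M" for i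
  proof -
    consider "i < k" | "i = k" | j where "i = Suc k + j"
      by (metis less_iff_Suc_add linorder_neqE_nat add_Suc)
    then show ?thesis
    proof cases
      case 1
      then have ci: "c i < M" using i s(1) by simp
      obtain j where j: "\<forall>l<j. c (Suc i + l) = c l" "c (Suc i + j) < c j"
        using up[OF ci] by (auto simp: lexless_def shift_def)
      have "Suc i + j \<le> k"
      proof (rule ccontr)
        assume "\<not> ?thesis"
        then have "border c i k" using j(1) 1 by (auto simp: border_def)
        then show False using k(3)[OF ci] by simp
      qed
      then consider "Suc i + j < k" | "Suc i + j = k" "c' k < c j" | "Suc i + j = k" "c' k = c j"
        using j(2) s(2) by fastforce
      then show ?thesis
      proof cases
        case 1
        then show ?thesis unfolding lexless_def shift_def using j s(1) by (intro exI[of _ j]) auto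
      next
        case 2
        then show ?thesis unfolding lexless_def shift_def using j s(1) by (intro exI[of _ j]) auto
      next
        case 3
        have "0 < c j" using 3(2) s(2) digitsD(1)[OF d, of k] by simp
        then obtain p where p: "Suc j + p \<le> k" "\<forall>l<p. M - c' (Suc j + l) = c l" "M - c' (Suc j + p) < c p"
          using mirr[of j] 3(1) by auto
        \<comment> \<open>The tail agrees with \<open>c'\<close> up to index \<open>j\<close>, and continues with the mirror image of \<open>c\<close>;
            that this is below what follows in \<open>c'\<close> is the mirrored condition at \<open>j\<close>.\<close>
        have low: "c' (Suc i + l) = c' l" if "l < j" for l
          using that j(1) 3(1) s(1) by simp
        have mid: "c' (Suc i + j) = c' j" using 3 s(1) by simp
        have high: "c' (Suc i + (Suc j + l)) = M - c l" for l
        proof -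
          have "Suc i + (Suc j + l) = Suc k + l" using 3(1) by simp
          then show ?thesis using s(3)[of l] by (simp only:)
        qed
        have "\<forall>l<Suc j + p. c' (Suc i + l) = c' l"
        proof (intro allI impI)
          fix l assume l: "l < Suc j + p"
          consider "l < j" | "l = j" | m where "l = Suc j + m"
            by (metis less_iff_Suc_add linorder_neqE_nat add_Suc)
          then show "c' (Suc i + l) = c' l"
          proof cases
            case (3 m)
            then have "M - c' (Suc j + m) = c m" using p(2) l by simp
            then show ?thesis unfolding 3 high by simp
          qed (use low mid in auto)
        qed
        moreover have "c' (Suc i + (Suc j + p)) < c' (Suc j + p)"
          unfolding high using p(3) by simp
        ultimately show ?thesis unfolding lexless_def shift_def by blast
      qed
    next
      case 2
      have "shift (Suc i) c' 0 = 0" using s(3)[of 0] c(2) 2 by (simp add: shift_def)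
      moreover have "c' 0 = M" using s(1) k(1) c(2) by simp
      ultimately show ?thesis unfolding lexless_def using c(3) by (intro exI[of _ 0]) auto
    next
      case (3 j)
      have "shift (Suc i) c' = mirror M (shift (Suc j) c)"
        using s(3)[of "Suc j + l" for l] 3 by (intro ext) (simp add: shift_def mirror_def add.assoc)
      moreover have "0 < c j" using i s(3)[of j] 3 by simp
      ultimately show ?thesis using lexless_trans[OF down cc'] by simp
    qed
  qed
  moreover have "lexless (mirror M (shift (Suc i) c')) c'" if i: "0 < c' i" for i
  proof -
    consider "i < k" | "i = k" | j where "i = Suc k + j"
      by (metis less_iff_Suc_add linorder_neqE_nat add_Suc)
    then show ?thesis
    proof cases
      case 1
      then have "0 < c i" using i s(1) by simp
      then obtain p where p: "Suc i + p \<le> k" "\<forall>l<p. M - c' (Suc i + l) = c l" "M - c' (Suc i + p) < c p"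
        using mirr[OF 1] by blast
      then show ?thesis unfolding lexless_def shift_def mirror_def using s(1)
        by (intro exI[of _ p]) auto
    next
      case 2
      have "mirror M (shift (Suc i) c') = c"
        using s(3) 2 by (auto simp: shift_def mirror_def)
      then show ?thesis using cc' by simp
    next
      case (3 j)
      have "mirror M (shift (Suc i) c') = shift (Suc j) c"
        using s(3)[of "Suc j + l" for l] 3 by (intro ext) (simp add: shift_def mirror_def add.assoc)
      moreover have "c j < M" using i s(3)[of j] 3 by simp
      ultimately show ?thesis using lexless_trans[OF up cc'] by simp
    qed
  qed
  ultimately show ?thesis
    unfolding admissible_def c'_def[symmetric]
    using digits_raise_at[OF d k(2), folded c'_def] by blast
qed

lemma univoque_right_limit:
  assumes U: "q \<in> univoque_bases" and q: "real_of_int M < q" "q < real_of_int M + 1" and "q < b"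
  shows "\<exists>p\<in>univoque_bases. q < p \<and> p < b"
proof -
  have q1: "1 < q" using U by (simp add: univoque_bases_def)
  have M: "0 < M" using q q1 by linarith
  obtain c where c: "digits M c" "dval q c = 1"
    by (rule univoque_expansion[OF U q(1) less_imp_le[OF q(2)]])
  have adm: "admissible M c" by (rule univoque_imp_admissible[OF U q(1) less_imp_le[OF q(2)] c])
  note tails = univoque_tails[OF U q(1) less_imp_le[OF q(2)] c]
  have "c 0 = M"
  proof (rule ccontr)
    assume "c 0 \<noteq> M"
    then have "c 0 < M" using digitsD(2)[OF c(1), of 0] by simp
    moreover from this have "remainder q c (Suc 0) < 1"
      using tails(1) remainder_expansion[OF q1 c] by metis
    then have "q - real_of_int (c 0) < 1" using q1 by (simp add: remainder_Suc)
    ultimately show False using q(1) by linarith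
  qed
  \<comment> \<open>It suffices that the modified sequence has value above 1 in base \<open>q\<close> and below 1 in a base \<open>x\<close>
      just above \<open>q\<close>; the latter holds if it agrees with \<open>c\<close> long enough.\<close>
  obtain x where x: "q < x" "x < min b (real_of_int M + 1)"
    using dense[of q "min b (real_of_int M + 1)"] assms by auto
  have "dval x c < 1"
    using dval_antimono_strict[OF q1 x(1) c(1), of 0] \<open>c 0 = M\<close> M c(2) by simp
  then obtain K where K: "\<And>c'. digits M c' \<Longrightarrow> \<forall>i<K. c' i = c i \<Longrightarrow>
      \<bar>dval x c' - dval x c\<bar> < 1 - dval x c"
    using dval_close[of x M "1 - dval x c"] x q1 M c(1) by auto
  obtain K' where "Suc K \<le> K'" "c K' < M"
    using univoque_not_eventually_max[OF U q c] by blast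
  then obtain k where k: "Suc K \<le> k" "c k < M" "\<And>i. c i < M \<Longrightarrow> \<not> border c i k"
    using exists_borderless[OF adm, of K'] by (meson order_trans)
  define c' where "c' = raise_at M k c"
  note s = raise_at_simps[where k = k and M = M and c = c, folded c'_def]
  have d': "digits M c'" unfolding c'_def by (rule digits_raise_at[OF c(1) k(2)])
  have adm': "admissible M c'"
    unfolding c'_def using k \<open>c 0 = M\<close> M by (intro admissible_raise_at[OF adm]) auto
  have "\<bar>dval x c' - dval x c\<bar> < 1 - dval x c"
    using s(1) k(1) by (intro K d') auto
  then have less: "dval x c' < 1" by linarith
  have more: "1 < dval q c'"
  proof -
    have "shift (Suc k) c' = mirror M c" using s(3) by (auto simp: shift_def mirror_def)
    then have "0 \<le> dval q (shift (Suc k) c') / q ^ Suc k"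
      using dval_nonneg[OF q1 digits_shift[OF d'], of "Suc k"] q1 by simp
    moreover have "(\<Sum>i<Suc k. real_of_int (c' i) / q ^ Suc i)
        = (\<Sum>i<Suc k. real_of_int (c i) / q ^ Suc i) + 1 / q ^ Suc k"
      using s by (simp add: add_divide_distrib)
    moreover have "dval q (shift (Suc k) c) / q ^ Suc k < 1 / q ^ Suc k"
      using tails(1)[OF k(2)] q1 by (intro divide_strict_right_mono) auto
    ultimately show ?thesis
      using dval_split[OF q1 d', of "Suc k"] dval_split[OF q1 c(1), of "Suc k"] c(2) by linarith
  qed
  obtain p where p: "q < p" "p < x" "dval p c' = 1"
    using exists_base[OF q1 x(1) d' more less] by blast
  have "p \<in> univoque_bases"
    using p x q q1 by (intro admissible_imp_univoque[OF _ _ _ adm']) auto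
  then show ?thesis using p x by (intro bexI[of _ p]) auto
qed

section \<open>A non-integer univoque base that is a limit of univoque bases from the left\<close>

text \<open>The sequence \<open>1 1 1 0 1 0 1 0 1 ...\<close>.\<close>

definition alt_seq :: "nat \<Rightarrow> int" where
  "alt_seq i = (if i < 3 \<or> even i then 1 else 0)"

text \<open>The sequence \<open>alt_seq\<close> up to index \<open>2 k + 3\<close>, continued by \<open>0 1 0 1 ...\<close> instead of
  \<open>1 0 1 0 ...\<close>; it is smaller than \<open>alt_seq\<close> and converges to it as \<open>k\<close> grows.\<close>

definition alt_seq_defect :: "nat \<Rightarrow> nat \<Rightarrow> int" where
  "alt_seq_defect k i = (if i < 3 then 1 else if i < 2 * k + 4 then (if even i then 1 else 0)
     else (if even i then 0 else 1))"

lemma admissible_alt_seq: "admissible 1 alt_seq"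
proof (rule admissible_if_no_blocks[where m = 3])
  show "\<exists>j<3. alt_seq (Suc i + j) < 1" if "alt_seq i < 1" for i
    using that by (intro exI[of _ 1]) (auto simp: alt_seq_def split: if_splits)
  show "\<exists>j<3. 0 < alt_seq (Suc i + j)" if "0 < alt_seq i" for i
    by (intro exI[of _ "if odd i then 0 else 1"]) (simp add: alt_seq_def)
qed (auto simp: digits_def alt_seq_def)

lemma admissible_alt_seq_defect: "admissible 1 (alt_seq_defect k)"
proof (rule admissible_if_no_blocks[where m = 3])
  let ?c = "alt_seq_defect k"
  have low: "i \<ge> 3 \<and> (if i < 2 * k + 4 then odd i else even i)" if "?c i < 1" for i
    using that by (auto simp: alt_seq_defect_def split: if_splits)
  show "\<exists>j<3. ?c (Suc i + j) < 1" if "?c i < 1" for i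
  proof (cases "i = 2 * k + 3")
    case True
    then show ?thesis by (intro exI[of _ 0]) (simp add: alt_seq_defect_def)
  next
    case False
    have i: "3 \<le> i" "if i < 2 * k + 4 then odd i else even i" using low[OF that] by auto
    have "?c (Suc i + 1) = 0"
    proof (cases "i < 2 * k + 4")
      case True
      then have "odd i" using i by simp
      then have "Suc i + 1 < 2 * k + 4" using True False by presburger
      then show ?thesis using i \<open>odd i\<close> by (simp add: alt_seq_defect_def)
    next
      case False
      then show ?thesis using i by (simp add: alt_seq_defect_def)
    qed
    then show ?thesis by (intro exI[of _ 1]) simp
  qed
  show "\<exists>j<3. 0 < ?c (Suc i + j)" for i
  proof (cases "0 < ?c (Suc i) \<or> 0 < ?c (Suc i + 1)")
    case True
    then show ?thesis by (metis add_0_right one_less_numeral_iff semiring_norm(77) zero_less_numeral)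
  next
    case False
    then have "i + 1 = 2 * k + 3"
      by (auto simp: alt_seq_defect_def split: if_splits; presburger)
    then have "0 < ?c (Suc i + 2)" by (simp add: alt_seq_defect_def)
    then show ?thesis by (intro exI[of _ 2]) simp
  qed
qed (auto simp: digits_def alt_seq_defect_def)

text \<open>The base of \<open>alt_seq\<close> is the limit from the left of the bases of \<open>alt_seq_defect k\<close>.\<close>

lemma exists_univoque_left_limit:
  "\<exists>q\<in>univoque_bases - pos_naturals. \<forall>a<q. \<exists>p\<in>univoque_bases. a < p \<and> p < q"
proof -
  have d: "digits 1 alt_seq" and d': "digits 1 (alt_seq_defect k)" for k
    by (auto simp: digits_def alt_seq_def alt_seq_defect_def)
  have "1 < dval (3/2) alt_seq"
  proof -
    have "(\<Sum>i<3. real_of_int (alt_seq i) / (3/2) ^ Suc i) > 1"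
      by (simp add: alt_seq_def eval_nat_numeral)
    moreover have "0 \<le> dval (3/2) (shift 3 alt_seq) / (3/2) ^ 3"
      using dval_nonneg[OF _ digits_shift[OF d]] by simp
    ultimately show ?thesis using dval_split[OF _ d, of "3/2" 3] by simp
  qed
  moreover have "dval 2 alt_seq < 1"
  proof -
    have "0 < dval 2 (mirror 1 alt_seq)"
      by (rule dval_pos[where i = 3, OF _ digits_mirror[OF d]]) (auto simp: mirror_def alt_seq_def)
    then show ?thesis using dval_mirror[OF _ d, of 2] by simp
  qed
  ultimately obtain q where q: "3/2 < q" "q < 2" "dval q alt_seq = 1"
    using exists_base[of "3/2" 2 1 alt_seq] d by auto
  have U: "q \<in> univoque_bases"
    using q by (intro admissible_imp_univoque[OF _ _ _ admissible_alt_seq]) auto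
  have "q \<notin> pos_naturals" using q by (auto simp: pos_naturals_def)
  moreover have "\<exists>p\<in>univoque_bases. a < p \<and> p < q" if a: "a < q" for a
  proof -
    obtain x where x: "max a (3/2) < x" "x < q" using dense[of "max a (3/2)" q] a q by auto
    have v: "1 < dval x alt_seq"
      using dval_antimono_strict[of x q 1 alt_seq 0] x q d by (simp add: alt_seq_def)
    then obtain K where K: "\<And>c'. digits 1 c' \<Longrightarrow> \<forall>i<K. c' i = alt_seq i \<Longrightarrow>
        \<bar>dval x c' - dval x alt_seq\<bar> < dval x alt_seq - 1"
      using dval_close[of x 1 "dval x alt_seq - 1"] x d by auto
    let ?c = "alt_seq_defect K"
    define m where "m = 2 * K + 4"
    have eq: "?c i = alt_seq i" if "i < m" for i
      using that by (simp add: alt_seq_def alt_seq_defect_def m_def)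
    have at_m: "?c m = 0" "alt_seq m = 1"
      by (simp_all add: alt_seq_def alt_seq_defect_def m_def)
    have "\<bar>dval x ?c - dval x alt_seq\<bar> < dval x alt_seq - 1"
      by (intro K d') (auto simp: eq m_def)
    then have more: "1 < dval x ?c" by linarith
    have less: "dval q ?c < 1"
    proof -
      have "shift (Suc m) ?c = shift 4 alt_seq"
        by (auto simp: shift_def alt_seq_def alt_seq_defect_def m_def)
      moreover have "dval q (shift (Suc 3) alt_seq) < 1"
        using q by (intro univoque_tails(1)[OF U _ _ d]) (auto simp: alt_seq_def)
      ultimately have "dval q (shift (Suc m) ?c) / q ^ Suc m < 1 / q ^ Suc m"
        using q by (intro divide_strict_right_mono) auto
      moreover have "(\<Sum>i<Suc m. real_of_int (alt_seq i) / q ^ Suc i)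
          = (\<Sum>i<Suc m. real_of_int (?c i) / q ^ Suc i) + 1 / q ^ Suc m"
        by (simp add: eq at_m)
      moreover have "0 \<le> dval q (shift (Suc m) alt_seq) / q ^ Suc m"
        using dval_nonneg[OF _ digits_shift[OF d], of q] q by simp
      ultimately show ?thesis
        using dval_split[OF _ d, of q "Suc m"] dval_split[OF _ d', of q K "Suc m"] q by linarith
    qed
    obtain p where p: "x < p" "p < q" "dval p ?c = 1"
      using exists_base[OF _ x(2) d' more less] x by auto
    have "p \<in> univoque_bases"
      using p x q by (intro admissible_imp_univoque[OF _ _ _ admissible_alt_seq_defect]) auto
    then show ?thesis using p x by (intro bexI[of _ p]) auto
  qed
  ultimately show ?thesis using U by blast
qed

section \<open>Endpoints of components\<close>

lemma mem_left_endpoints_iff: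
  assumes "open S"
  shows "p \<in> left_endpoints S \<longleftrightarrow> p \<notin> S \<and> (\<exists>e>p. {p<..<e} \<subseteq> S)"
proof
  assume "p \<in> left_endpoints S"
  then obtain C where C: "C \<in> components S" "bdd_below C" "p = Inf C"
    by (auto simp: left_endpoints_def)
  have ne: "C \<noteq> {}" and sub: "C \<subseteq> S" and conn: "connected C"
    using in_components_nonempty[OF C(1)] in_components_subset[OF C(1)]
      in_components_connected[OF C(1)] by auto
  have cl: "p \<in> closure C" using C ne closure_contains_Inf by blast
  have "open C" using assms C(1) open_components by blast
  have "p \<notin> C"
  proof
    assume "p \<in> C"
    then obtain e where e: "e > 0" "ball p e \<subseteq> C" using \<open>open C\<close> open_contains_ball by blast
    then have "p - e / 2 \<in> C" by (auto simp: dist_real_def)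
    then have "p \<le> p - e / 2" using cInf_lower[OF _ C(2)] C(3) by metis
    then show False using e by simp
  qed
  moreover have "p \<in> C" if "p \<in> S"
  proof -
    have "connected (insert p C)"
      using connected_intermediate_closure[OF conn] cl closure_subset by blast
    then have "insert p C \<subseteq> C"
      using ne sub that by (intro components_maximal[OF C(1)]) auto
    then show ?thesis by simp
  qed
  moreover obtain x where x: "x \<in> C" using ne by blast
  moreover have "p < x" using x \<open>p \<notin> C\<close> C cInf_lower[OF x C(2)] by (cases "p = x") auto
  moreover have "{p<..<x} \<subseteq> C"
  proof
    fix y assume y: "y \<in> {p<..<x}"
    then obtain z where "z \<in> C" "z < y" using C ne cInf_lessD by (metis greaterThanLessThan_iff)
    then show "y \<in> C" using connected_contains_Icc[OF conn _ x] y by force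
  qed
  ultimately show "p \<notin> S \<and> (\<exists>e>p. {p<..<e} \<subseteq> S)" using sub by blast
next
  assume "p \<notin> S \<and> (\<exists>e>p. {p<..<e} \<subseteq> S)"
  then obtain e where p: "p \<notin> S" and e: "p < e" "{p<..<e} \<subseteq> S" by blast
  have "S \<noteq> {}" using e dense[of p e] by auto
  then obtain C where C: "C \<in> components S" "{p<..<e} \<subseteq> C"
    using exists_component_superset[OF e(2)] connected_Ioo by blast
  have lower: "p \<le> z" if "z \<in> C" for z
  proof (rule ccontr)
    assume "\<not> p \<le> z"
    obtain y where y: "p < y" "y < e" using e(1) dense by blast
    then have "y \<in> C" using C(2) by auto
    then have "{z..y} \<subseteq> C"
      using connected_contains_Icc[OF in_components_connected[OF C(1)] that] by blast
    then have "p \<in> C" using y(1) \<open>\<not> p \<le> z\<close> by auto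
    then show False using p in_components_subset[OF C(1)] by blast
  qed
  have "Inf C = p"
  proof (rule cInf_eq_non_empty)
    show "C \<noteq> {}" using C(1) in_components_nonempty by blast
    show "y \<le> p" if "\<And>x. x \<in> C \<Longrightarrow> y \<le> x" for y
    proof (rule dense_ge_bounded[OF e(1)])
      show "y \<le> x" if "p < x" "x < e" for x using \<open>\<And>x. x \<in> C \<Longrightarrow> y \<le> x\<close> C(2) that by auto
    qed
  qed (rule lower)
  moreover have "bdd_below C" using lower by (rule bdd_belowI)
  ultimately show "p \<in> left_endpoints S"
    using C(1) unfolding left_endpoints_def by blast
qed

lemma right_endpointsD:
  assumes "open S" "p \<in> right_endpoints S"
  shows "p \<notin> S \<and> (\<exists>e<p. {e<..<p} \<subseteq> S)"
proof -
  obtain C where C: "C \<in> components S" "bdd_above C" "p = Sup C"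
    using assms(2) by (auto simp: right_endpoints_def)
  have ne: "C \<noteq> {}" and sub: "C \<subseteq> S" and conn: "connected C"
    using in_components_nonempty[OF C(1)] in_components_subset[OF C(1)]
      in_components_connected[OF C(1)] by auto
  have cl: "p \<in> closure C" using C ne closure_contains_Sup by blast
  have "open C" using assms C(1) open_components by blast
  have "p \<notin> C"
  proof
    assume "p \<in> C"
    then obtain e where e: "e > 0" "ball p e \<subseteq> C" using \<open>open C\<close> open_contains_ball by blast
    then have "p + e / 2 \<in> C" by (auto simp: dist_real_def)
    then have "p + e / 2 \<le> p" using cSup_upper[OF _ C(2)] C(3) by metis
    then show False using e by simp
  qed
  moreover have "p \<in> C" if "p \<in> S"
  proof -
    have "connected (insert p C)"
      using connected_intermediate_closure[OF conn] cl closure_subset by blast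
    then have "insert p C \<subseteq> C"
      using ne sub that by (intro components_maximal[OF C(1)]) auto
    then show ?thesis by simp
  qed
  moreover obtain x where x: "x \<in> C" using ne by blast
  moreover have "x < p" using x \<open>p \<notin> C\<close> C cSup_upper[OF x C(2)] by (cases "p = x") auto
  moreover have "{x<..<p} \<subseteq> C"
  proof
    fix y assume y: "y \<in> {x<..<p}"
    then obtain z where "z \<in> C" "y < z" using C ne less_cSupD by (metis greaterThanLessThan_iff)
    then show "y \<in> C" using connected_contains_Icc[OF conn x] y by force
  qed
  ultimately show ?thesis using sub by blast
qed

lemma non_natural_between:
  assumes "1 < q" "q \<notin> pos_naturals"
  shows "real_of_int \<lfloor>q\<rfloor> < q" "q < real_of_int \<lfloor>q\<rfloor> + 1"
proof -
  have "real_of_int \<lfloor>q\<rfloor> \<noteq> q"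
  proof
    assume "real_of_int \<lfloor>q\<rfloor> = q"
    moreover have "1 \<le> \<lfloor>q\<rfloor>" using assms(1) by linarith
    ultimately have "q = real (nat \<lfloor>q\<rfloor>)" "1 \<le> nat \<lfloor>q\<rfloor>" by auto
    then show False using assms(2) unfolding pos_naturals_def by blast
  qed
  then show "real_of_int \<lfloor>q\<rfloor> < q" "q < real_of_int \<lfloor>q\<rfloor> + 1" by linarith+
qed

theorem mainTheorem11:
  "left_endpoints ({1<..} - closure univoque_bases)
     = pos_naturals \<union> (closure univoque_bases - univoque_bases)
   \<and> right_endpoints ({1<..} - closure univoque_bases)
     \<subset> univoque_bases - pos_naturals"
proof -
  let ?U = univoque_bases and ?N = pos_naturals
  let ?S = "{1<..} - closure ?U"
  have S: "open ?S" by (intro open_Diff) auto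
  have disj: "I \<inter> closure ?U = {}" if "open I" "I \<inter> ?U = {}" for I :: "real set"
    using that open_Int_closure_eq_empty by blast
  have U1: "1 < q" if "q \<in> ?U" for q using that by (simp add: univoque_bases_def)
  have cl1: "1 < q" if "q \<in> closure ?U" for q
  proof -
    obtain e where e: "1 < e" "{1<..<e} \<inter> ?U = {}" using gap_right_of_integer[of 1] by auto
    have "{..<e} \<inter> ?U = {}" using e(2) U1 unfolding disjoint_iff by auto
    then have "{..<e} \<inter> closure ?U = {}" by (intro disj) auto
    then have "\<not> q < e" using that by (auto simp: disjoint_iff)
    then show ?thesis using e(1) by simp
  qed
  have N2: "\<exists>n. 2 \<le> n \<and> q = real n" if "q \<in> ?N" "1 < q" for q
    using that by (auto simp: pos_naturals_def)
  have gap: "\<exists>e>q. {q<..<e} \<inter> ?U = {}" if "q \<in> ?N \<or> 1 < q \<and> q \<notin> ?U" for q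
  proof (cases "q \<in> ?N")
    case True
    then show ?thesis using gap_right_of_integer by (auto simp: pos_naturals_def)
  next
    case False
    then have "1 < q" "q \<notin> ?U" using that by auto
    then show ?thesis
      using gap_right_of_non_univoque non_natural_between[OF _ False] by blast
  qed
  have left: "p \<in> left_endpoints ?S \<longleftrightarrow> p \<in> ?N \<union> (closure ?U - ?U)" for p
  proof
    assume "p \<in> left_endpoints ?S"
    then obtain e where p: "p \<notin> ?S" and e: "p < e" "{p<..<e} \<subseteq> ?S"
      unfolding mem_left_endpoints_iff[OF S] by blast
    have "1 \<le> p"
    proof (rule ccontr)
      assume "\<not> 1 \<le> p"
      then obtain y where "p < y" "y < min e 1" using e(1) dense[of p "min e 1"] by auto
      then show False using e(2) by auto
    qed
    show "p \<in> ?N \<union> (closure ?U - ?U)"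
    proof (rule ccontr)
      assume n: "\<not> ?thesis"
      have "1 \<in> ?N" unfolding pos_naturals_def by (auto intro: exI[of _ 1])
      then have "1 < p" using n \<open>1 \<le> p\<close> by (cases "p = 1") auto
      then have "p \<in> ?U" "p \<notin> ?N" using p n by auto
      then obtain r where "r \<in> ?U" "p < r" "r < e"
        using univoque_right_limit[OF _ non_natural_between[OF \<open>1 < p\<close>] e(1)] by blast
      then show False using e(2) closure_subset[of ?U] by auto
    qed
  next
    assume p: "p \<in> ?N \<union> (closure ?U - ?U)"
    have "1 \<le> p" using p cl1 by (auto simp: pos_naturals_def less_imp_le)
    obtain e where e: "p < e" "{p<..<e} \<inter> ?U = {}" using gap[of p] p cl1 by blast
    have "{p<..<e} \<subseteq> ?S" using disj[OF _ e(2)] \<open>1 \<le> p\<close> by auto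
    moreover have "p \<notin> ?S"
    proof
      assume "p \<in> ?S"
      then obtain n where n: "2 \<le> n" "p = real n" using p N2 by auto
      obtain d where d: "d > 0" "ball p d \<subseteq> ?S"
        using S \<open>p \<in> ?S\<close> open_contains_ball by blast
      obtain r where r: "r \<in> ?U" "p - d < r" "r < p"
        using integer_left_limit[OF n(1), of "p - d"] n(2) d(1) by auto
      then have "r \<in> ball p d" by (simp add: dist_real_def)
      then show False using d(2) r(1) closure_subset[of ?U] by blast
    qed
    ultimately show "p \<in> left_endpoints ?S"
      unfolding mem_left_endpoints_iff[OF S] using e(1) by blast
  qed
  have right: "p \<in> ?U - ?N" if p_right: "p \<in> right_endpoints ?S" for p
  proof -
    obtain e where p: "p \<notin> ?S" and e: "e < p" "{e<..<p} \<subseteq> ?S"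
      using right_endpointsD[OF S p_right] by blast
    have no: "\<not> (\<exists>r\<in>?U. e < r \<and> r < p)" using e(2) closure_subset[of ?U] by auto
    have "1 < p"
    proof -
      obtain y where "e < y" "y < p" using e(1) dense by blast
      then show ?thesis using e(2) by force
    qed
    then have cl: "p \<in> closure ?U" using p by simp
    have "p \<notin> ?N" using N2[OF _ \<open>1 < p\<close>] integer_left_limit no e(1) by blast
    moreover have "p \<in> ?U"
    proof (rule ccontr)
      assume "p \<notin> ?U"
      then obtain d where d: "p < d" "{p<..<d} \<inter> ?U = {}" using gap[of p] \<open>1 < p\<close> by blast
      \<comment> \<open>The base \<open>p\<close> would be isolated from \<open>U\<close> on both sides.\<close>
      have "{e<..<d} \<inter> ?U = {}"
      proof -
        have "r \<notin> ?U" if "e < r" "r < d" for r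
          using that no d(2) \<open>p \<notin> ?U\<close> by (cases r p rule: linorder_cases) auto
        then show ?thesis by auto
      qed
      then have "{e<..<d} \<inter> closure ?U = {}" by (intro disj) auto
      then show False using cl e(1) d(1) by auto
    qed
    ultimately show ?thesis by blast
  qed
  obtain q where q: "q \<in> ?U - ?N" "\<forall>a<q. \<exists>p\<in>?U. a < p \<and> p < q"
    using exists_univoque_left_limit by blast
  have "q \<notin> right_endpoints ?S"
  proof
    assume "q \<in> right_endpoints ?S"
    then obtain e where e: "e < q" "{e<..<q} \<subseteq> ?S" using right_endpointsD[OF S] by blast
    then show False using q(2) closure_subset[of ?U] by force
  qed
  then show ?thesis using left right q(1) by blast
qed

end
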